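(* There exists an absolute constant $C>0$ such that the following holds. Let $(G,\cdot)$ be a group and let $A,B\subseteq G$ be finite subsets. If $2<|A\cdot B|\le K|A|$ for some positive integer $K$, then \[\dim B\le C\cdot K\cdot\log(K|A|)\cdot\log\log(K|A|).\]
   Context: All logarithms are natural. $A\cdot B=\{ab: a\in A, b\in B\}$. For a group $G$ with identity $e$, a subset $S\subseteq G$ is dissociated if there is no solution to $g_1^{\varepsilon_1}\cdots g_m^{\varepsilon_m}=e$ with $m\ge1$, distinct $g_1,\dots,g_m\in S$ and $\varepsilon_1,\dots,\varepsilon_m\in\{-1,1\}$. For a finite $B\subseteq G$, $\dim B$ is the maximum cardinality of a dissociated subset of $B$. *)

theory Defs
  imports Complex_Main "HOL-Algebra.Coset"
begin

(* The list gs fixes the order of the factors, so for non-abelian G all orderings of the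
   distinct elements are covered. *)
definition dissociated :: "('a, 'b) monoid_scheme \<Rightarrow> 'a set \<Rightarrow> bool" where
  "dissociated G S \<longleftrightarrow> S \<subseteq> carrier G \<and>
     \<not> (\<exists>(gs :: 'a list) (es :: int list).
          gs \<noteq> [] \<and> distinct gs \<and> set gs \<subseteq> S \<and>
          length es = length gs \<and> set es \<subseteq> {-1, 1} \<and>
          foldr (\<otimes>\<^bsub>G\<^esub>) (map2 (\<lambda>g e. g [^]\<^bsub>G\<^esub> e) gs es) \<one>\<^bsub>G\<^esub> = \<one>\<^bsub>G\<^esub>)"

(* Only meaningful for finite B; the maximum is then over a finite set of numbers that
   contains 0, as the empty set is dissociated. *)
definition group_dim :: "('a, 'b) monoid_scheme \<Rightarrow> 'a set \<Rightarrow> nat" where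
  "group_dim G B = Max {card S | S. S \<subseteq> B \<and> dissociated G S}"

definition dim_bound :: "real \<Rightarrow> ('a, 'b) monoid_scheme \<Rightarrow> bool" where
  "dim_bound C G \<longleftrightarrow>
     (\<forall>(A :: 'a set) (B :: 'a set) (K :: nat).
        A \<subseteq> carrier G \<and> finite A \<and> B \<subseteq> carrier G \<and> finite B \<and> K > 0 \<and>
        2 < card (A <#>\<^bsub>G\<^esub> B) \<and> card (A <#>\<^bsub>G\<^esub> B) \<le> K * card A \<longrightarrow>
        real (group_dim G B)
          \<le> C * real K * ln (real K * real (card A)) * ln (ln (real K * real (card A))))"

(* HOL cannot quantify over all groups of all types below an existential quantifier: in
   "EX C > 0. ALL G :: 'a monoid. group G --> dim_bound C G" the constant C might depend on
   the type 'a. To state that C is absolute, the theorem asserts that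
     (1) some C > 0 works for all groups with carrier a set of natural numbers, and
     (2) every C > 0 as in (1) works for all groups over an arbitrary type 'a.
   The condition on C in (1) mentions no type variable, so a C chosen there is one constant
   for all groups of all types, by (2). *)

end

theory Submission
  imports Defs "HOL-Algebra.Generated_Groups" "HOL-Library.Countable_Set"
begin

text \<open>
  Join \<open>a \<in> A\<close> to \<open>a s \<in> A \<cdot> S\<close> by an edge of colour \<open>s\<close>. This bipartite graph is properly
  coloured, has average degree at least \<open>|S| / K\<close>, and has no rainbow closed walk when \<open>S\<close> is
  dissociated. A subset \<open>V\<close> of the vertices that maximises \<open>e(V)/|V| - \<alpha> ln |V|\<close> spans an
  expander: each nonempty \<open>U \<subseteq> V\<close> has at least \<open>\<alpha> |U| ln (|V|/|U|)\<close> edges to \<open>V - U\<close>. Let \<open>R\<close> be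
  the set of vertices reached from a fixed vertex by rainbow walks in \<open>V\<close> with colours in a random
  set that contains each colour with probability \<open>p\<close>. By Russo's formula and the expansion,
  \<open>g(p) = E ln (|V|/|R|)\<close> satisfies \<open>g' \<le> - (\<alpha>/2) g\<close>, hence \<open>g(1/2) \<le> exp (- \<alpha>/4) ln |V|\<close>. On
  the other hand the sets reached with a set of colours and with its complement share only the
  starting vertex, so \<open>g(1/2) \<ge> ln (4/3)\<close>. Hence \<open>\<alpha>\<close> is at most of order \<open>ln ln |V|\<close>, and the
  average degree at most of order \<open>ln n ln ln n\<close> for \<open>n\<close> vertices.

  A bound for groups on the natural numbers transfers to all groups, because the subgroup generated
  by \<open>A \<union> B\<close> is countable.
\<close>

section \<open>Means over a random subset of a finite set\<close>

text \<open>For \<open>p\<close> between 0 and 1 this is the expectation of \<open>f C\<close> when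
  each element of \<open>S\<close> enters \<open>C\<close> independently with probability
  \<open>p\<close>.\<close>

definition cube_mean :: "'c set \<Rightarrow> ('c set \<Rightarrow> real) \<Rightarrow> real \<Rightarrow> real" where
  "cube_mean S f p = (\<Sum>C\<in>Pow S. p ^ card C * (1 - p) ^ card (S - C) * f C)"

text \<open>Conditioning on whether \<open>s\<close> lies in the random set; the inductions on
  \<open>S\<close> below rest on it.\<close>

lemma cube_mean_insert:
  assumes "finite S" "s \<notin> S"
  shows "cube_mean (insert s S) f p =
    p * cube_mean S (\<lambda>C. f (insert s C)) p + (1 - p) * cube_mean S f p"
proof -
  have inj: "inj_on (insert s) (Pow S)"
    using assms(2) by (auto simp: inj_on_def)
  have disj: "Pow S \<inter> insert s ` Pow S = {}"
    using assms(2) by auto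
  have c1: "card (insert s S - C) = Suc (card (S - C))" if "C \<subseteq> S" for C
  proof -
    have "insert s S - C = insert s (S - C)" using that assms(2) by auto
    then show ?thesis using assms by simp
  qed
  have c2: "card (insert s C) = Suc (card C)" "insert s S - insert s C = S - C" if "C \<subseteq> S" for C
    using that assms finite_subset[OF that] by (auto simp: card_insert_if)
  show ?thesis
    unfolding cube_mean_def Pow_insert
    using assms disj inj
    by (simp add: sum.union_disjoint sum.reindex sum_distrib_left c1 c2 mult_ac)
qed

lemma cube_mean_add:
  "cube_mean S (\<lambda>C. f C + g C) p = cube_mean S f p + cube_mean S g p"
  by (simp add: cube_mean_def ring_distribs sum.distrib)

lemma cube_mean_diff:
  "cube_mean S (\<lambda>C. f C - g C) p = cube_mean S f p - cube_mean S g p"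
  by (simp add: cube_mean_def ring_distribs sum_subtractf)

lemma cube_mean_cmult: "cube_mean S (\<lambda>C. k * f C) p = k * cube_mean S f p"
  by (simp add: cube_mean_def sum_distrib_left mult_ac)

lemma cube_mean_cong:
  assumes "\<And>C. C \<subseteq> S \<Longrightarrow> f C = g C"
  shows "cube_mean S f p = cube_mean S g p"
  using assms by (simp add: cube_mean_def)

lemma cube_mean_mono:
  assumes "0 \<le> p" "p \<le> 1" "\<And>C. C \<subseteq> S \<Longrightarrow> f C \<le> g C"
  shows "cube_mean S f p \<le> cube_mean S g p"
  unfolding cube_mean_def using assms by (intro sum_mono mult_left_mono) auto

lemma cube_mean_const:
  assumes "finite S"
  shows "cube_mean S (\<lambda>_. k) p = k"
  using assms
proof (induction S rule: finite_induct)
  case empty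
  show ?case by (simp add: cube_mean_def)
next
  case (insert s S)
  then show ?case by (simp add: cube_mean_insert algebra_simps)
qed

lemma cube_mean_0:
  assumes "finite S"
  shows "cube_mean S f 0 = f {}"
  using assms
proof (induction S rule: finite_induct)
  case empty
  show ?case by (simp add: cube_mean_def)
next
  case (insert s S)
  then show ?case by (simp add: cube_mean_insert)
qed

text \<open>At \<open>p = 1/2\<close> a random set and its complement have the same
  distribution.\<close>

lemma cube_mean_half_complement:
  assumes "finite S"
  shows "cube_mean S (\<lambda>C. f (S - C)) (1/2) = cube_mean S f (1/2)"
  unfolding cube_mean_def
proof (rule sum.reindex_bij_witness[where i = "\<lambda>C. S - C" and j = "\<lambda>C. S - C"])
  fix C assume "C \<in> Pow S"
  then have "S - (S - C) = C" by blast
  then show "(1 / 2) ^ card (S - C) * (1 - 1 / 2) ^ card (S - (S - C)) * f (S - C) =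
        (1 / 2) ^ card C * (1 - 1 / 2) ^ card (S - C) * f (S - C)"
    by simp
qed auto

text \<open>The Margulis--Russo formula.\<close>

lemma has_real_derivative_cube_mean:
  assumes "finite S"
  shows "(cube_mean S f has_real_derivative
    cube_mean S (\<lambda>C. \<Sum>c\<in>S. f (insert c C) - f (C - {c})) p) (at p)"
  using assms
proof (induction S arbitrary: f rule: finite_induct)
  case empty
  have "cube_mean {} f = (\<lambda>p. f {})" by (auto simp: cube_mean_def)
  then show ?case by (simp add: cube_mean_def)
next
  case (insert s S)
  let ?D = "\<lambda>f C. \<Sum>c\<in>S. f (insert c C) - f (C - {c})"
  let ?g = "\<lambda>C. f (insert s C)"
  have eq: "cube_mean (insert s S) f = (\<lambda>p. p * cube_mean S ?g p + (1 - p) * cube_mean S f p)"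
    using insert.hyps by (auto simp: cube_mean_insert)
  have "((\<lambda>p. p * cube_mean S ?g p + (1 - p) * cube_mean S f p) has_real_derivative
     (cube_mean S ?g p + p * cube_mean S (?D ?g) p
      + (- cube_mean S f p + (1 - p) * cube_mean S (?D f) p))) (at p)"
    by (rule derivative_eq_intros insert.IH refl | simp)+
  \<comment> \<open>The new element \<open>s\<close> contributes \<open>?g C - f C\<close> whether
    or not it lies in the random set; differentiating the weights \<open>p\<close> and
    \<open>1 - p\<close> gives the same term.\<close>
  moreover have "cube_mean (insert s S) (\<lambda>C. \<Sum>c\<in>insert s S. f (insert c C) - f (C - {c})) p
     = p * cube_mean S (\<lambda>C. (?g C - f C) + ?D ?g C) p
       + (1 - p) * cube_mean S (\<lambda>C. (?g C - f C) + ?D f C) p"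
  proof -
    have *: "insert s C - {s} = C" "C - {s} = C" "insert s C - {c} = insert s (C - {c})"
      if "C \<subseteq> S" "c \<in> S" for C c
      using that insert.hyps by auto
    have **: "insert s C - {s} = C" "C - {s} = C" if "C \<subseteq> S" for C
      using that insert.hyps by auto
    have "cube_mean S (\<lambda>C. \<Sum>c\<in>insert s S. f (insert c (insert s C)) - f (insert s C - {c})) p
       = cube_mean S (\<lambda>C. (?g C - f C) + ?D ?g C) p"
      using insert.hyps
      by (intro cube_mean_cong) (auto simp: * ** insert_commute intro!: sum.cong)
    moreover have "cube_mean S (\<lambda>C. \<Sum>c\<in>insert s S. f (insert c C) - f (C - {c})) p
       = cube_mean S (\<lambda>C. (?g C - f C) + ?D f C) p"
      using insert.hyps by (intro cube_mean_cong) (auto simp: **)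
    ultimately show ?thesis
      using insert.hyps by (simp add: cube_mean_insert)
  qed
  moreover have "\<dots> = cube_mean S ?g p + p * cube_mean S (?D ?g) p
      + (- cube_mean S f p + (1 - p) * cube_mean S (?D f) p)"
    by (simp only: cube_mean_add cube_mean_diff) (simp add: algebra_simps)
  ultimately show ?case
    by (simp only: eq)
qed

text \<open>A Gronwall argument: Russo's formula turns \<open>step\<close> into
  \<open>g' <= - k * g\<close> for the gap \<open>g = L - cube_mean S f\<close>, so
  \<open>exp (k * p) * g\<close> does not increase.\<close>

lemma cube_mean_growth:
  assumes fin: "finite S"
    and step: "\<And>C. C \<subseteq> S \<Longrightarrow>
      k * (L - f C) \<le> (\<Sum>c\<in>S. f (insert c C) - f (C - {c}))"
    and p: "0 \<le> p" "p \<le> 1"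
  shows "L - cube_mean S f p \<le> exp (- k * p) * (L - f {})"
proof -
  let ?D = "\<lambda>C. \<Sum>c\<in>S. f (insert c C) - f (C - {c})"
  let ?h = "\<lambda>p. exp (k * p) * (L - cube_mean S f p)"
  have "?h p \<le> ?h 0"
  proof (rule DERIV_nonpos_imp_nonincreasing[OF p(1)])
    fix x assume x: "0 \<le> x" "x \<le> p"
    have "k * (L - cube_mean S f x) = cube_mean S (\<lambda>C. k * (L - f C)) x"
      using fin by (simp add: cube_mean_cmult cube_mean_diff cube_mean_const)
    also have "\<dots> \<le> cube_mean S ?D x"
      using x p step by (intro cube_mean_mono) auto
    finally have "exp (k * x) * (k * (L - cube_mean S f x) - cube_mean S ?D x) \<le> 0"
      by (simp add: mult_le_0_iff)
    moreover have "(?h has_real_derivative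
        exp (k * x) * (k * (L - cube_mean S f x) - cube_mean S ?D x)) (at x)"
      by (rule derivative_eq_intros has_real_derivative_cube_mean[OF fin] refl
          | simp add: algebra_simps)+
    ultimately show "\<exists>y. DERIV ?h x :> y \<and> y \<le> 0" by blast
  qed
  then have "exp (- k * p) * ?h p \<le> exp (- k * p) * (L - f {})"
    using fin by (intro mult_left_mono) (auto simp: cube_mean_0)
  then show ?thesis
    by (simp add: mult.assoc[symmetric] exp_add[symmetric])
qed

section \<open>Expanders and rainbow walks in properly coloured graphs\<close>

locale coloured_graph =
  fixes E :: "'c \<Rightarrow> 'v \<Rightarrow> 'v \<Rightarrow> bool" and S :: "'c set"
  assumes finite_colours: "finite S"
    and sym: "E c u w \<Longrightarrow> E c w u"
    and proper: "E c u w \<Longrightarrow> E c u w' \<Longrightarrow> w = w'"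
    and irrefl: "\<not> E c u u"
begin

text \<open>The colour belongs to the triple, so parallel edges of different colours count
  separately.\<close>

definition edges :: "'v set \<Rightarrow> 'v set \<Rightarrow> ('c \<times> 'v \<times> 'v) set" where
  "edges U W = (SIGMA c:S. {(u, w). u \<in> U \<and> w \<in> W \<and> E c u w})"

lemma finite_edges: "finite U \<Longrightarrow> finite W \<Longrightarrow> finite (edges U W)"
  by (rule finite_subset[of _ "S \<times> U \<times> W"]) (auto simp: edges_def finite_colours)

lemma card_edges_commute: "card (edges U W) = card (edges W U)"
  by (rule bij_betw_same_card[where f = "\<lambda>(c, u, w). (c, w, u)"],
      rule bij_betw_byWitness[where f' = "\<lambda>(c, u, w). (c, w, u)"])
     (auto simp: edges_def sym)

lemma card_edges_split:
  assumes "finite V" "U \<subseteq> V"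
  shows "card (edges V V) =
    card (edges U U) + card (edges (V - U) (V - U)) + 2 * card (edges U (V - U))"
proof -
  let ?W = "V - U"
  have fin: "finite U" "finite ?W" using assms finite_subset by auto
  have "edges V V = (edges U U \<union> edges ?W ?W) \<union> (edges U ?W \<union> edges ?W U)"
    using assms(2) by (auto simp: edges_def)
  also have "card \<dots> = card (edges U U \<union> edges ?W ?W) + card (edges U ?W \<union> edges ?W U)"
    using fin by (intro card_Un_disjoint) (auto simp: finite_edges, auto simp: edges_def)
  also have "card (edges U U \<union> edges ?W ?W) = card (edges U U) + card (edges ?W ?W)"
    using fin by (intro card_Un_disjoint) (auto simp: finite_edges, auto simp: edges_def)
  also have "card (edges U ?W \<union> edges ?W U) = card (edges U ?W) + card (edges ?W U)"
    using fin by (intro card_Un_disjoint) (auto simp: finite_edges, auto simp: edges_def)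
  finally show ?thesis by (simp add: card_edges_commute[of ?W U])
qed

text \<open>Maximality of \<open>V\<close> bounds the edges inside \<open>U\<close> and inside
  \<open>V - U\<close>. Subtracting both from the edges of \<open>V\<close> cancels the terms with
  \<open>f V\<close>, since the sizes add up, and leaves the logarithms as a lower bound for the
  edges between.\<close>

lemma obtain_expander:
  fixes \<alpha> :: real
  assumes fin: "finite V0" and \<alpha>: "0 \<le> \<alpha>"
    and dense: "2 * \<alpha> * card V0 * ln (card V0) < card (edges V0 V0)"
  obtains V where "V \<subseteq> V0" "2 \<le> card V"
    "\<And>U. U \<subseteq> V \<Longrightarrow> U \<noteq> {} \<Longrightarrow>
       \<alpha> * card U * (ln (card V) - ln (card U)) \<le> card (edges U (V - U))"
proof -
  \<comment> \<open>\<open>edges U U\<close> contains both orientations of each edge, hence the factor 2.\<close>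
  define f where "f U = card (edges U U) / card U - 2 * \<alpha> * ln (card U)" for U
  have ne: "V0 \<noteq> {}" using dense by (auto simp: edges_def)
  then have c0: "card V0 > 0" using fin by (simp add: card_gt_0_iff)
  let ?P = "Pow V0 - {{}}"
  have P: "finite ?P" "?P \<noteq> {}" using fin ne by auto
  obtain V where V: "V \<in> ?P" "\<And>U. U \<in> ?P \<Longrightarrow> f U \<le> f V"
  proof -
    have "Max (f ` ?P) \<in> f ` ?P" using P by (intro Max_in) auto
    then obtain V where "V \<in> ?P" "f V = Max (f ` ?P)" by (metis imageE)
    moreover have "f U \<le> Max (f ` ?P)" if "U \<in> ?P" for U
      using that P(1) by (intro Max_ge) auto
    ultimately show thesis using that by metis
  qed
  have finV: "finite V" using V fin finite_subset by auto
  have cV: "card V > 0" using V finV by (auto simp: card_gt_0_iff)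
  have up: "card (edges U U) \<le> card U * (f V + 2 * \<alpha> * ln (card U))" if "U \<subseteq> V" for U
  proof (cases "U = {}")
    case True
    then show ?thesis by (simp add: edges_def)
  next
    case False
    have "finite U" using that finV finite_subset by blast
    with False have "card U > 0" by (simp add: card_gt_0_iff)
    moreover have "f U \<le> f V" using that False V by blast
    ultimately show ?thesis by (simp add: f_def field_simps)
  qed
  have eV: "card (edges V V) = card V * (f V + 2 * \<alpha> * ln (card V))"
    using cV by (simp add: f_def field_simps)
  have "0 < f V0" using dense c0 by (simp add: f_def field_simps)
  also have "\<dots> \<le> f V" using V ne by blast
  finally have fV: "0 < f V" .
  \<comment> \<open>A single vertex spans no edge and would give \<open>f V = 0\<close>.\<close>
  have "card V \<noteq> 1"
  proof
    assume "card V = 1"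
    then obtain x where "V = {x}" by (auto simp: card_1_singleton_iff)
    then have "edges V V = {}" using irrefl by (auto simp: edges_def)
    then show False using fV \<open>card V = 1\<close> by (simp add: f_def)
  qed
  with cV have "2 \<le> card V" by linarith
  moreover have "\<alpha> * card U * (ln (card V) - ln (card U)) \<le> card (edges U (V - U))"
    if U: "U \<subseteq> V" "U \<noteq> {}" for U
  proof -
    let ?W = "V - U"
    have cVU: "real (card V) = card U + card ?W"
      using U finV by (simp add: card_Diff_subset finite_subset card_mono of_nat_diff)
    have "card V * (f V + 2 * \<alpha> * ln (card V)) =
        card (edges U U) + card (edges ?W ?W) + 2 * card (edges U ?W)"
      using eV card_edges_split[OF finV U(1)] by simp
    also have "\<dots> \<le> card U * (f V + 2 * \<alpha> * ln (card U)) + card ?W * (f V + 2 * \<alpha> * ln (card ?W))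
        + 2 * card (edges U ?W)"
      using up[OF U(1)] up[of ?W] by auto
    finally have "\<alpha> * card U * (ln (card V) - ln (card U))
       + \<alpha> * card ?W * (ln (card V) - ln (card ?W)) \<le> card (edges U ?W)"
      unfolding cVU by (simp add: algebra_simps)
    \<comment> \<open>The term of \<open>?W\<close> only helps and is dropped. If \<open>?W\<close>
      is empty, the factor \<open>card ?W\<close> makes the value of \<open>ln 0\<close>
      irrelevant.\<close>
    moreover have "0 \<le> \<alpha> * card ?W * (ln (card V) - ln (card ?W))"
    proof (cases "card ?W = 0")
      case False
      then have "ln (card ?W) \<le> ln (card V)" using cV cVU by simp
      then show ?thesis using \<alpha> by simp
    qed simp
    ultimately show ?thesis by linarith
  qed
  moreover have "V \<subseteq> V0" using V by blast
  ultimately show ?thesis using that by blast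
qed

primrec walk :: "'v set \<Rightarrow> 'v \<Rightarrow> 'c list \<Rightarrow> 'v \<Rightarrow> bool" where
  "walk V u [] w \<longleftrightarrow> u \<in> V \<and> u = w"
| "walk V u (c # cs) w \<longleftrightarrow> u \<in> V \<and> (\<exists>x. E c u x \<and> walk V x cs w)"

lemma walk_endpoints: "walk V u cs w \<Longrightarrow> u \<in> V \<and> w \<in> V"
  by (induction cs arbitrary: u) auto

lemma walk_append: "walk V u cs x \<Longrightarrow> walk V x ds w \<Longrightarrow> walk V u (cs @ ds) w"
  by (induction cs arbitrary: u) auto

lemma walk_rev: "walk V u cs w \<Longrightarrow> walk V w (rev cs) u"
proof (induction cs arbitrary: u)
  case (Cons c cs)
  then obtain x where "u \<in> V" "E c u x" "walk V x cs w" by auto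
  then show ?case
    using walk_append[OF Cons.IH, of x "[c]" u] walk_endpoints sym by fastforce
qed auto

lemma walk_mono: "walk V u cs w \<Longrightarrow> V \<subseteq> V' \<Longrightarrow> walk V' u cs w"
  by (induction cs arbitrary: u) auto

text \<open>Vertices may repeat, only colours must differ; hence walks with disjoint colour sets
  concatenate to a rainbow walk.\<close>

definition reach :: "'v set \<Rightarrow> 'v \<Rightarrow> 'c set \<Rightarrow> 'v set" where
  "reach V v C = {w. \<exists>cs. walk V v cs w \<and> distinct cs \<and> set cs \<subseteq> C}"

lemma reach_subset: "reach V v C \<subseteq> V"
  by (auto simp: reach_def dest: walk_endpoints)

lemma start_in_reach: "v \<in> V \<Longrightarrow> v \<in> reach V v C"
  unfolding reach_def by (auto intro!: exI[of _ "[]"])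

lemma reach_mono: "C \<subseteq> D \<Longrightarrow> reach V v C \<subseteq> reach V v D"
  by (auto simp: reach_def)

lemma reach_step:
  assumes "u \<in> reach V v C" "c \<notin> C" "E c u w" "w \<in> V"
  shows "w \<in> reach V v (insert c C)"
proof -
  obtain cs where cs: "walk V v cs u" "distinct cs" "set cs \<subseteq> C"
    using assms(1) by (auto simp: reach_def)
  have "walk V u [c] w" using assms walk_endpoints[OF cs(1)] by auto
  from walk_append[OF cs(1) this] show ?thesis
    using cs assms(2) unfolding reach_def by (auto intro!: exI[of _ "cs @ [c]"])
qed

text \<open>Going to a common endpoint with colours of \<open>C\<close> and back with colours of
  \<open>D\<close> is a rainbow closed walk, hence empty.\<close>

lemma reach_disjoint_colours:
  assumes rainbow_free: "\<And>v cs. walk V v cs v \<Longrightarrow> distinct cs \<Longrightarrow> set cs \<subseteq> S \<Longrightarrow> cs = []"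
    and "C \<inter> D = {}" "C \<subseteq> S" "D \<subseteq> S"
  shows "reach V v C \<inter> reach V v D \<subseteq> {v}"
proof
  fix w assume "w \<in> reach V v C \<inter> reach V v D"
  then obtain cs ds where "walk V v cs w" "distinct cs" "set cs \<subseteq> C"
      "walk V v ds w" "distinct ds" "set ds \<subseteq> D"
    by (auto simp: reach_def)
  moreover from this have "cs @ rev ds = []"
    using assms(2-4) by (intro rainbow_free[of v] walk_append walk_rev) auto
  ultimately show "w \<in> {v}" by simp
qed

text \<open>A boundary edge \<open>uw\<close> of colour \<open>c\<close> makes \<open>c\<close> pivotal: for reaching \<open>w\<close> if \<open>c \<notin> C\<close>,
  and for reaching \<open>u\<close> if \<open>c \<in> C\<close>. Hence no boundary edge is lost to an already used colour.\<close>

lemma ln_card_reach_growth: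
  assumes fin: "finite V" and v: "v \<in> V"
  shows "card (edges (reach V v C) (V - reach V v C)) / (2 * card (reach V v C))
    \<le> (\<Sum>c\<in>S. ln (card (reach V v (insert c C))) - ln (card (reach V v (C - {c}))))"
proof -
  let ?R = "reach V v C"
  let ?r = "real (card ?R)"
  define X where "X c = {(u, w). u \<in> ?R \<and> w \<in> V - ?R \<and> E c u w}" for c
  have finR: "finite (reach V v D)" for D
    using fin reach_subset finite_subset by metis
  have pos: "card (reach V v D) > 0" for D
    using finR start_in_reach[OF v] by (auto simp: card_gt_0_iff)
  have finX: "finite (X c)" for c
    by (rule finite_subset[of _ "?R \<times> V"]) (auto simp: X_def finR fin)
  \<comment> \<open>Each colour class is a matching, so the edges in \<open>X c\<close> have
    distinct inner ends and distinct outer ends.\<close>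
  have injs: "inj_on fst (X c)" "inj_on snd (X c)" for c
    by (auto simp: inj_on_def X_def dest: proper proper[OF sym sym])
  have le: "card (X c) \<le> card ?R" for c
    by (rule card_inj_on_le[OF injs(1) _ finR]) (auto simp: X_def)
  have "card (X c) / (2 * ?r) \<le>
      ln (card (reach V v (insert c C))) - ln (card (reach V v (C - {c})))" for c
  proof (cases "c \<in> C")
    case False
    have "?R \<union> snd ` X c \<subseteq> reach V v (insert c C)"
      using False reach_mono[of C "insert c C"] by (auto simp: X_def intro: reach_step)
    then have "card (?R \<union> snd ` X c) \<le> card (reach V v (insert c C))"
      by (intro card_mono finR)
    moreover have "card (?R \<union> snd ` X c) = card ?R + card (X c)"
      using finR finX injs(2)
      by (subst card_Un_disjoint) (auto simp: X_def card_image)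
    ultimately have big: "?r + card (X c) \<le> card (reach V v (insert c C))" by linarith
    have r: "?r > 0" using pos by simp
    \<comment> \<open>By \<open>card (X c) <= ?r\<close>; the logarithm is then reached through
      \<open>1 - 1/t <= ln t\<close>.\<close>
    have "card (X c) / (2 * ?r) \<le> card (X c) / (?r + card (X c))"
      using r le[of c] by (intro divide_left_mono) (auto intro: mult_pos_pos add_pos_nonneg)
    also have "\<dots> = 1 - ?r / (?r + card (X c))"
      using r by (simp add: field_simps)
    also have "\<dots> \<le> ln ((?r + card (X c)) / ?r)"
      using r ln_le_minus_one[of "?r / (?r + card (X c))"]
      by (simp add: ln_div add_pos_nonneg)
    also have "\<dots> = ln (?r + card (X c)) - ln ?r"
      using r by (simp add: ln_div add_pos_nonneg)
    also have "\<dots> \<le> ln (card (reach V v (insert c C))) - ln ?r"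
      using big r by simp
    finally show ?thesis using False by simp
  next
    case True
    then have ins: "insert c (C - {c}) = C" "insert c C = C" by auto
    \<comment> \<open>If \<open>u\<close> were reached without \<open>c\<close>, appending
      \<open>c\<close> would bring \<open>w\<close> into \<open>?R\<close>. So removing
      \<open>c\<close> loses all inner ends of \<open>X c\<close>.\<close>
    have "u \<notin> reach V v (C - {c})" if "(u, w) \<in> X c" for u w
      using reach_step[of u V v "C - {c}" c w] that by (auto simp: ins X_def)
    then have "reach V v (C - {c}) \<subseteq> ?R - fst ` X c"
      using reach_mono[of "C - {c}" C] by fastforce
    then have "card (reach V v (C - {c})) \<le> card (?R - fst ` X c)"
      by (intro card_mono) (auto simp: finR)
    moreover have "card (?R - fst ` X c) = card ?R - card (X c)"
      using finX injs(1) by (subst card_Diff_subset) (auto simp: X_def card_image)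
    ultimately have small: "real (card (reach V v (C - {c}))) \<le> ?r - card (X c)"
      using le[of c] by linarith
    let ?q = "real (card (reach V v (C - {c})))"
    have r: "?r > 0" "?q > 0" using pos by auto
    have "card (X c) / (2 * ?r) \<le> 1 - ?q / ?r"
      using r small by (simp add: field_simps)
    also have "\<dots> \<le> ln ?r - ln ?q"
      using r ln_le_minus_one[of "?q / ?r"] by (simp add: ln_div)
    finally show ?thesis by (simp add: ins)
  qed
  then have "(\<Sum>c\<in>S. card (X c) / (2 * ?r)) \<le>
      (\<Sum>c\<in>S. ln (card (reach V v (insert c C))) - ln (card (reach V v (C - {c}))))"
    by (intro sum_mono)
  moreover have "card (edges ?R (V - ?R)) = (\<Sum>c\<in>S. card (X c))"
    unfolding edges_def using finX finite_colours by (simp add: X_def card_SigmaI)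
  ultimately show ?thesis by (simp add: sum_divide_distrib)
qed

text \<open>Two estimates of the mean logarithmic gap between \<open>V\<close> and the reached set
  at \<open>p = 1/2\<close>: expansion bounds it from above, complementary colour sets from
  below.\<close>

lemma expansion_bound:
  fixes \<alpha> :: real
  assumes fin: "finite V" and V: "2 \<le> card V"
    and expander: "\<And>U. U \<subseteq> V \<Longrightarrow> U \<noteq> {} \<Longrightarrow>
       \<alpha> * card U * (ln (card V) - ln (card U)) \<le> card (edges U (V - U))"
    and rainbow_free: "\<And>v cs. walk V v cs v \<Longrightarrow> distinct cs \<Longrightarrow> set cs \<subseteq> S \<Longrightarrow> cs = []"
  shows "ln (4 / 3) \<le> exp (- \<alpha> / 4) * ln (card V)"
proof -
  from V obtain v where v: "v \<in> V" by fastforce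
  define n where "n = real (card V)"
  define r where "r C = real (card (reach V v C))" for C
  have n: "n \<ge> 2" using V by (simp add: n_def)
  have finR: "finite (reach V v D)" for D
    using fin reach_subset finite_subset by metis
  have pos: "r C \<ge> 1" for C
    using finR[of C] start_in_reach[OF v, of C] unfolding r_def
    by (metis One_nat_def Suc_leI card_gt_0_iff empty_iff of_nat_1 of_nat_mono)
  \<comment> \<open>Decay at rate \<open>\<alpha> / 2\<close> for \<open>p\<close> from 0 to 1/2
    gives the exponent \<open>- \<alpha> / 4\<close>.\<close>
  have "ln n - cube_mean S (\<lambda>C. ln (r C)) (1/2)
      \<le> exp (- (\<alpha> / 2) * (1/2)) * (ln n - ln (r {}))"
  proof (rule cube_mean_growth[OF finite_colours])
    fix C
    let ?R = "reach V v C"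
    have "\<alpha> * r C * (ln n - ln (r C)) \<le> card (edges ?R (V - ?R))"
      using expander[OF reach_subset[of V v C]] start_in_reach[OF v, of C]
      by (auto simp: n_def r_def)
    then have "\<alpha> / 2 * (ln n - ln (r C)) \<le> card (edges ?R (V - ?R)) / (2 * r C)"
      using pos[of C] by (simp add: field_simps)
    also have "\<dots> \<le> (\<Sum>c\<in>S. ln (r (insert c C)) - ln (r (C - {c})))"
      using ln_card_reach_growth[OF fin v] by (simp add: r_def)
    finally show "\<alpha> / 2 * (ln n - ln (r C)) \<le> (\<Sum>c\<in>S. ln (r (insert c C)) - ln (r (C - {c})))" .
  qed auto
  also have "\<dots> \<le> exp (- \<alpha> / 4) * ln n"
    using pos[of "{}"] by simp
  finally have upper: "ln n - cube_mean S (\<lambda>C. ln (r C)) (1/2) \<le> exp (- \<alpha> / 4) * ln n" .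
  have "ln (r C) + ln (r (S - C)) \<le> 2 * (ln (3 / 4) + ln n)" if C: "C \<subseteq> S" for C
  proof -
    have "card (reach V v C) + card (reach V v (S - C)) =
        card (reach V v C \<union> reach V v (S - C)) + card (reach V v C \<inter> reach V v (S - C))"
      by (rule card_Un_Int[OF finR finR])
    also have "\<dots> \<le> card V + card {v}"
      using reach_disjoint_colours[OF rainbow_free, where C = C and D = "S - C" and v = v] C
      by (intro add_mono card_mono fin) (use reach_subset in auto)
    finally have "r C + r (S - C) \<le> n + 1"
      by (simp add: r_def n_def)
    \<comment> \<open>\<open>n >= 2\<close> gives \<open>n + 1 <= 3/2 * n\<close>; this is the
      source of \<open>3 / 4\<close>, and so of \<open>ln (4 / 3)\<close>.\<close>
    also have "\<dots> \<le> 2 * (3 / 4 * n)" using n by simp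
    finally have sum: "r C + r (S - C) \<le> 2 * (3 / 4 * n)" .
    \<comment> \<open>The inequality of arithmetic and geometric means passes from the sum to the
      product, that is, to the sum of the logarithms.\<close>
    have "4 * (r C * r (S - C)) \<le> (r C + r (S - C))\<^sup>2"
      using sum_squares_ge_zero[of "r C - r (S - C)" 0] by (simp add: power2_eq_square algebra_simps)
    also have "\<dots> \<le> (2 * (3 / 4 * n))\<^sup>2"
      using sum pos[of C] pos[of "S - C"] by (intro power_mono) auto
    finally have "r C * r (S - C) \<le> (3 / 4 * n)\<^sup>2" by (simp add: power2_eq_square)
    then have "ln (r C * r (S - C)) \<le> ln ((3 / 4 * n)\<^sup>2)"
      using pos[of C] pos[of "S - C"] n by (intro ln_mono) (auto intro!: mult_pos_pos)
    moreover have "ln (r C * r (S - C)) = ln (r C) + ln (r (S - C))"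
      using pos[of C] pos[of "S - C"] by (intro ln_mult_pos) auto
    moreover have "ln ((3 / 4 * n)\<^sup>2) = 2 * (ln (3 / 4) + ln n)"
      using n ln_mult_pos[of "3 / 4" n] by (simp add: ln_realpow)
    ultimately show ?thesis by simp
  qed
  then have "cube_mean S (\<lambda>C. ln (r C) + ln (r (S - C))) (1/2)
      \<le> cube_mean S (\<lambda>C. 2 * (ln (3 / 4) + ln n)) (1/2)"
    by (intro cube_mean_mono) auto
  then have "cube_mean S (\<lambda>C. ln (r C)) (1/2) \<le> ln (3 / 4) + ln n"
    using finite_colours cube_mean_half_complement[OF finite_colours, of "\<lambda>C. ln (r C)"]
    by (simp add: cube_mean_add cube_mean_const)
  moreover have "ln (3 / 4) = - ln (4 / 3 :: real)"
    by (simp add: ln_div)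
  ultimately show ?thesis using upper by (simp add: n_def)
qed

text \<open>With more edges, \<open>V\<close> would contain an expander, which inherits the absence
  of rainbow closed walks and contradicts \<open>expansion_bound\<close>.\<close>

theorem card_edges_rainbow_free:
  assumes fin: "finite V" and V: "2 \<le> card V"
    and rainbow_free: "\<And>v cs. walk V v cs v \<Longrightarrow> distinct cs \<Longrightarrow> set cs \<subseteq> S \<Longrightarrow> cs = []"
  shows "card (edges V V) \<le>
    2 * (4 * ln (ln (card V) / ln (4 / 3)) + 1) * card V * ln (card V)"
proof (rule ccontr)
  \<comment> \<open>The logarithm makes \<open>exp (- \<alpha> / 4) * ln (card V)\<close> equal to
    \<open>ln (4 / 3)\<close>, and the added 1 makes it smaller.\<close>
  define \<alpha> where "\<alpha> = 4 * ln (ln (card V) / ln (4 / 3)) + 1"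
  assume "\<not> ?thesis"
  then have dense: "2 * \<alpha> * card V * ln (card V) < card (edges V V)"
    by (simp add: \<alpha>_def)
  have l: "0 < ln (4 / 3 :: real)" by simp
  have lV: "ln (4 / 3) \<le> ln (card V)" using V by (intro ln_mono) auto
  with l have lV0: "0 < ln (card V)" by linarith
  have "0 \<le> \<alpha>" using l lV by (simp add: \<alpha>_def)
  from obtain_expander[OF fin this dense] obtain V' where V': "V' \<subseteq> V" "2 \<le> card V'"
    "\<And>U. U \<subseteq> V' \<Longrightarrow> U \<noteq> {} \<Longrightarrow>
       \<alpha> * card U * (ln (card V') - ln (card U)) \<le> card (edges U (V' - U))"
    by blast
  have "ln (4 / 3) \<le> exp (- \<alpha> / 4) * ln (card V')"
  proof (rule expansion_bound)
    show "finite V'" using V'(1) fin by (rule finite_subset)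
    show "cs = []" if "walk V' v cs v" "distinct cs" "set cs \<subseteq> S" for v cs
      using rainbow_free walk_mono[OF that(1) V'(1)] that by blast
  qed (use V' in auto)
  also have "\<dots> \<le> exp (- \<alpha> / 4) * ln (card V)"
    using V' fin V card_mono[OF fin V'(1)] by simp
  also have "exp (- \<alpha> / 4) < exp (- ln (ln (card V) / ln (4 / 3)))"
    by (simp add: \<alpha>_def)
  also have "\<dots> = ln (4 / 3) / ln (card V)"
    using l lV0 by (subst exp_minus, subst exp_ln) (auto intro: divide_pos_pos)
  finally show False using l lV by simp
qed

end

section \<open>A numerical estimate and dissociated sets of maximum size\<close>

lemma ln_3_gt_1: "1 < ln (3 :: real)"
proof -
  \<comment> \<open>The bound \<open>1 + x + x^2\<close> at \<open>x = 1\<close> gives only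
    \<open>exp 1 <= 3\<close>; at \<open>x = 1/4\<close> its fourth power is below 3.\<close>
  have "exp 1 = exp (1 / 4 :: real) ^ 4" by (simp flip: exp_of_nat_mult)
  also have "\<dots> \<le> (1 + 1 / 4 + (1 / 4)\<^sup>2) ^ 4"
    using exp_bound[of "1 / 4"] by (intro power_mono) auto
  also have "\<dots> < 3" by (simp add: power2_eq_square power4_eq_xxxx)
  finally have "ln (exp 1) < ln (3 :: real)" by (subst ln_less_cancel_iff) auto
  then show ?thesis by simp
qed

lemma group_dim_attained:
  assumes "finite B"
  obtains S where "S \<subseteq> B" "dissociated G S" "card S = group_dim G B"
proof -
  have "group_dim G B \<in> {card S | S. S \<subseteq> B \<and> dissociated G S}"
    unfolding group_dim_def
  proof (rule Max_in)
    show "finite {card S |S. S \<subseteq> B \<and> dissociated G S}"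
      using assms by simp
    have "dissociated G {}" by (auto simp: dissociated_def)
    then show "{card S |S. S \<subseteq> B \<and> dissociated G S} \<noteq> {}" by blast
  qed
  then show ?thesis using that by auto
qed

lemma card_le_group_dim:
  assumes "finite B" "S \<subseteq> B" "dissociated G S"
  shows "card S \<le> group_dim G B"
  unfolding group_dim_def using assms by (intro Max_ge) auto

section \<open>The bipartite graph of a product set\<close>

text \<open>The sum type keeps the two sides apart even where \<open>A\<close> and
  \<open>A <#> S\<close> overlap, and excludes loops.\<close>

definition cayley_edge ::
  "('a, 'b) monoid_scheme \<Rightarrow> 'a \<Rightarrow> 'a + 'a \<Rightarrow> 'a + 'a \<Rightarrow> bool" where
  "cayley_edge G s u w \<longleftrightarrow> s \<in> carrier G \<and> (\<exists>a\<in>carrier G.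
     u = Inl a \<and> w = Inr (a \<otimes>\<^bsub>G\<^esub> s) \<or> u = Inr (a \<otimes>\<^bsub>G\<^esub> s) \<and> w = Inl a)"

context group
begin

lemma coloured_graph_cayley_edge:
  assumes "finite S"
  shows "coloured_graph (cayley_edge G) S"
  by unfold_locales (auto simp: cayley_edge_def assms)

lemma cayley_edge_imp_power:
  assumes "cayley_edge G s u w"
  shows "\<exists>e\<in>{-1, 1 :: int}. case_sum id id w = case_sum id id u \<otimes> s [^] e"
  using assms by (auto simp: cayley_edge_def int_pow_neg m_assoc)

lemma foldr_mult_closed: "set xs \<subseteq> carrier G \<Longrightarrow> foldr (\<otimes>) xs \<one> \<in> carrier G"
  by (induction xs) auto

text \<open>Each edge multiplies on the right by \<open>s\<close> or its inverse, depending on its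
  direction. So the factors appear in the order of the walk, as the ordered products in
  \<open>dissociated\<close> require.\<close>

lemma walk_cayley_edge_imp_product:
  assumes "coloured_graph.walk (cayley_edge G) V u cs w"
    and "V \<subseteq> carrier G <+> carrier G" "set cs \<subseteq> carrier G"
  shows "\<exists>es :: int list. length es = length cs \<and> set es \<subseteq> {-1, 1} \<and>
    case_sum id id w =
      case_sum id id u \<otimes> foldr (\<otimes>) (map2 (\<lambda>g e. g [^] e) cs es) \<one>"
proof -
  \<comment> \<open>\<open>walk\<close> depends on the edge relation alone, so any finite colour set
    serves.\<close>
  interpret coloured_graph "cayley_edge G" "{}"
    by (rule coloured_graph_cayley_edge) simp
  have car: "case_sum id id x \<in> carrier G" if "x \<in> V" for x
    using that assms(2) by auto
  show ?thesis
    using assms(1,3)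
  proof (induction cs arbitrary: u)
    case Nil
    then show ?case using car by auto
  next
    case (Cons c cs)
    then obtain x where x: "u \<in> V" "cayley_edge G c u x" "walk V x cs w" by auto
    obtain es :: "int list" where es: "length es = length cs" "set es \<subseteq> {-1, 1}"
      "case_sum id id w = case_sum id id x \<otimes> foldr (\<otimes>) (map2 (\<lambda>g e. g [^] e) cs es) \<one>"
      using Cons.IH[OF x(3)] Cons.prems by auto
    obtain e :: int where e: "e \<in> {-1, 1}" "case_sum id id x = case_sum id id u \<otimes> c [^] e"
      using cayley_edge_imp_power[OF x(2)] by blast
    have "foldr (\<otimes>) (map2 (\<lambda>g e. g [^] e) cs es) \<one> \<in> carrier G"
      using Cons.prems(2) es(1)
      by (intro foldr_mult_closed) (auto dest!: set_zip_leftD intro!: int_pow_closed)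
    then show ?case
      using es e car[OF x(1)] Cons.prems(2)
      by (intro exI[of _ "e # es"]) (auto simp: m_assoc)
  qed
qed

text \<open>The pairs in \<open>S \<times> A\<close> are edges of a graph with \<open>n\<close>
  vertices, in which a rainbow closed walk would be a relation among distinct elements of
  \<open>S\<close>.\<close>

lemma dissociated_card_bound:
  assumes A: "A \<subseteq> carrier G" "finite A" "A \<noteq> {}"
    and S: "dissociated G S" "finite S" "S \<noteq> {}"
  defines "n \<equiv> card A + card (A <#> S)"
  shows "2 \<le> n" and "card S * card A \<le> (4 * ln (ln n / ln (4 / 3)) + 1) * n * ln n"
proof -
  interpret coloured_graph "cayley_edge G" S
    by (rule coloured_graph_cayley_edge[OF S(2)])
  define V where "V = A <+> (A <#> S)"
  have carS: "S \<subseteq> carrier G" using S by (simp add: dissociated_def)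
  have AS: "A <#> S \<subseteq> carrier G" by (rule set_mult_closed[OF A(1) carS])
  have finAS: "finite (A <#> S)"
    using A S by (auto simp: set_mult_def)
  have "A <#> S \<noteq> {}" using A S by (auto simp: set_mult_def)
  with finAS A have "0 < card A" "0 < card (A <#> S)" by (auto simp: card_gt_0_iff)
  then show "2 \<le> n" by (simp add: n_def)
  have finV: "finite V" using A finAS by (simp add: V_def)
  have cV: "card V = n" using A finAS by (simp add: V_def n_def card_Plus)
  have free: "cs = []" if cs: "walk V v cs v" "distinct cs" "set cs \<subseteq> S" for v cs
  proof (rule ccontr)
    assume "cs \<noteq> []"
    have Vc: "V \<subseteq> carrier G <+> carrier G" using A AS by (auto simp: V_def)
    have csc: "set cs \<subseteq> carrier G" using cs carS by blast
    have v: "case_sum id id v \<in> carrier G" using walk_endpoints[OF cs(1)] Vc by auto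
    obtain es :: "int list" where es: "length es = length cs" "set es \<subseteq> {-1, 1}"
      "case_sum id id v = case_sum id id v \<otimes> foldr (\<otimes>) (map2 (\<lambda>g e. g [^] e) cs es) \<one>"
      using walk_cayley_edge_imp_product[OF cs(1) Vc csc] by blast
    have "foldr (\<otimes>) (map2 (\<lambda>g e. g [^] e) cs es) \<one> \<in> carrier G"
      using csc
      by (intro foldr_mult_closed) (auto dest!: set_zip_leftD intro!: int_pow_closed)
    with es v have "foldr (\<otimes>) (map2 (\<lambda>g e. g [^] e) cs es) \<one> = \<one>"
      by (simp add: l_cancel_one')
    with S(1) cs es \<open>cs \<noteq> []\<close> show False
      unfolding dissociated_def by blast
  qed
  let ?U = "Inl ` A"
  have "2 * (card S * card A) = 2 * card (S \<times> A)" by (simp add: card_cartesian_product)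
  also have "card (S \<times> A) = card ((\<lambda>(s, a). (s, Inl a :: 'a + 'a, Inr (a \<otimes> s) :: 'a + 'a)) ` (S \<times> A))"
    by (rule card_image[symmetric]) (auto simp: inj_on_def)
  also have "\<dots> \<le> card (edges ?U (V - ?U))"
    using A carS finV
    by (intro card_mono finite_edges)
       (auto simp: edges_def V_def cayley_edge_def set_mult_def subset_iff)
  also have "2 * \<dots> \<le> card (edges V V)"
    using card_edges_split[OF finV, of ?U] by (simp add: V_def Plus_def)
  finally have "2 * real (card S * card A) \<le> card (edges V V)" by linarith
  also have "\<dots> \<le> 2 * (4 * ln (ln n / ln (4 / 3)) + 1) * n * ln n"
    using card_edges_rainbow_free[OF finV _ free] \<open>2 \<le> n\<close> by (simp add: cV)
  finally show "card S * card A \<le> (4 * ln (ln n / ln (4 / 3)) + 1) * n * ln n" by (simp add: algebra_simps)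
qed

section \<open>The bound with an explicit constant\<close>

text \<open>The factor 4 comes from \<open>n <= 2 * M\<close> and \<open>ln n <= 2 * ln M\<close>,
  and 13 is \<open>4 * 3 + 1\<close> by \<open>ln 8 <= 3\<close>. Since
  \<open>ln (ln M) >= ln (ln 3) > 0\<close>, dividing 13 by \<open>ln (ln 3)\<close> absorbs it into
  \<open>ln (ln M)\<close>.\<close>

lemma dim_bound_explicit: "dim_bound (4 * (4 + 13 / ln (ln 3))) G"
  unfolding dim_bound_def
proof (intro allI impI, elim conjE)
  fix A B :: "'a set" and K :: nat
  assume A: "A \<subseteq> carrier G" "finite A" and B: "B \<subseteq> carrier G" "finite B"
    and K: "K > 0" "2 < card (A <#> B)" "card (A <#> B) \<le> K * card A"
  define M where "M = real K * real (card A)"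
  have M: "3 \<le> M" using K unfolding M_def by (metis Suc_leI numeral_2_eq_2 numeral_3_eq_3
      of_nat_mult of_nat_numeral of_nat_mono le_trans)
  note ln3 = ln_3_gt_1
  have lnM: "ln 3 \<le> ln M" using M by simp
  then have llM: "0 < ln (ln 3 :: real)" "ln (ln 3) \<le> ln (ln M)"
    using ln3 by auto
  define b where "b = 4 * (4 + 13 / ln (ln 3)) * real K * ln M * ln (ln M)"
  have b: "0 \<le> b"
    using lnM llM ln3 unfolding b_def
    by (intro mult_nonneg_nonneg add_nonneg_nonneg divide_nonneg_nonneg) auto
  have bound: "card S \<le> b" if S: "S \<subseteq> B" "dissociated G S" for S
  proof (cases "S = {}")
    case True
    then show ?thesis using b by simp
  next
    case False
    have finS: "finite S" using S B finite_subset by blast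
    have neA: "A \<noteq> {}" using M by (auto simp: M_def)
    have finAB: "finite (A <#> B)" using A B by (auto simp: set_mult_def)
    define n where "n = card A + card (A <#> S)"
    note d = dissociated_card_bound[OF A neA S(2) finS False, folded n_def]
    have "card (A <#> S) \<le> card (A <#> B)"
      using S by (intro card_mono finAB) (auto simp: set_mult_def)
    moreover have "card A \<le> K * card A" using K by simp
    ultimately have "real n \<le> real (2 * (K * card A))"
      using K unfolding n_def of_nat_le_iff by linarith
    then have nM: "n \<le> 2 * M" by (simp add: M_def)
    have q: "1 / 4 \<le> ln (4 / 3 :: real)"
      using ln_le_minus_one[of "3 / 4 :: real"] by (simp add: ln_div)
    have n0: "2 \<le> real n" using d(1) by simp
    have lnn: "ln n \<le> 2 * ln M"
    \<comment> \<open>Here \<open>2 * M <= M^2\<close> because \<open>M >= 3\<close>.\<close>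
    proof -
      have "ln n \<le> ln (M\<^sup>2)"
        using nM n0 M by (intro ln_mono) (auto simp: power2_eq_square intro: order_trans mult_right_mono)
      then show ?thesis using M by (simp add: ln_realpow)
    qed
    have lnn0: "ln (4 / 3) \<le> ln n" using n0 by simp
    have "ln n / ln (4 / 3) \<le> 2 * ln M / (1 / 4)"
      using lnn lnn0 q by (intro frac_le) auto
    then have "ln (ln n / ln (4 / 3)) \<le> ln (8 * ln M)"
      using lnn0 q by (intro ln_mono) auto
    also have "\<dots> = ln (2 ^ 3) + ln (ln M)"
      using lnM ln3 by (subst ln_mult_pos) auto
    also have "ln (2 ^ 3 :: real) \<le> 3"
      using ln_le_minus_one[of 2] by (subst ln_realpow) auto
    finally have l: "4 * ln (ln n / ln (4 / 3)) + 1 \<le> 13 + 4 * ln (ln M)" by simp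
    have l0: "0 \<le> ln (ln n / ln (4 / 3))" using lnn0 q by simp
    have "card S * real (card A) \<le> (4 * ln (ln n / ln (4 / 3)) + 1) * n * ln n"
      using d(2) by simp
    also have "\<dots> \<le> (13 + 4 * ln (ln M)) * (2 * M) * (2 * ln M)"
      using l l0 nM lnn lnn0 q n0 llM M
      by (intro mult_mono mult_nonneg_nonneg) linarith+
    also have "\<dots> = (4 * real K * ln M * (13 + 4 * ln (ln M))) * card A"
      by (simp add: M_def algebra_simps)
    finally have "card S \<le> 4 * real K * ln M * (13 + 4 * ln (ln M))"
      using neA A by (simp add: card_gt_0_iff)
    also have "\<dots> \<le> 4 * real K * ln M * ((13 / ln (ln 3)) * ln (ln M) + 4 * ln (ln M))"
      using llM lnM ln3 by (intro mult_left_mono add_right_mono) (auto simp: field_simps)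
    also have "\<dots> = b" by (simp add: b_def algebra_simps)
    finally show ?thesis .
  qed
  obtain S where "S \<subseteq> B" "dissociated G S" "card S = group_dim G B"
    using group_dim_attained[OF B(2)] .
  with bound[of S] show "group_dim G B \<le> 4 * (4 + 13 / ln (ln 3)) * real K * ln (real K * card A) * ln (ln (real K * card A))"
    by (simp add: b_def M_def)
qed

section \<open>Transfer to groups over arbitrary types\<close>

text \<open>Every generated element is the product of a word over \<open>H\<close> and the inverses
  of \<open>H\<close>, and there are countably many words.\<close>

lemma countable_generate:
  assumes "countable H" "H \<subseteq> carrier G"
  shows "countable (generate G H)"
proof -
  let ?L = "lists (H \<union> m_inv G ` H)"
  let ?prod = "\<lambda>xs. foldr (\<otimes>) xs \<one>"
  have car: "?prod xs \<in> carrier G" if "xs \<in> ?L" for xs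
    using that assms(2) by (induction xs) auto
  have app: "?prod (xs @ ys) = ?prod xs \<otimes> ?prod ys" if "xs \<in> ?L" "ys \<in> ?L" for xs ys
    using that
  proof (induction xs)
    case (Cons x xs)
    then show ?case using assms(2) car[of xs] car[of ys] by (auto simp: m_assoc)
  qed (use car in auto)
  have "generate G H \<subseteq> ?prod ` ?L"
  proof
    fix x assume "x \<in> generate G H"
    then show "x \<in> ?prod ` ?L"
    proof induction
      case one
      show ?case by (auto intro: image_eqI[of _ _ "[]"])
    next
      case (incl h)
      then show ?case using assms(2) by (auto intro!: image_eqI[of _ _ "[h]"])
    next
      case (inv h)
      then show ?case using assms(2) by (auto intro!: image_eqI[of _ _ "[inv h]"])
    next
      case (eng h1 h2)
      then obtain xs ys where "xs \<in> ?L" "ys \<in> ?L" "h1 = ?prod xs" "h2 = ?prod ys" by blast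
      then have "h1 \<otimes> h2 = ?prod (xs @ ys)" "xs @ ys \<in> ?L" by (simp_all only: app) auto
      then show ?case by (rule image_eqI)
    qed
  qed
  moreover have "countable (?prod ` ?L)" using assms(1) by simp
  ultimately show ?thesis by (rule countable_subset)
qed

end

lemma (in group_hom) dissociated_image:
  assumes inj: "inj_on h (carrier G)" and S: "S \<subseteq> carrier G" "dissociated H (h ` S)"
  shows "dissociated G S"
  unfolding dissociated_def
proof (intro conjI notI S(1), elim exE conjE)
  fix gs :: "'a list" and es :: "int list"
  let ?pw = "\<lambda>g e. g [^]\<^bsub>G\<^esub> e"
  assume gs: "gs \<noteq> []" "distinct gs" "set gs \<subseteq> S" "length es = length gs" "set es \<subseteq> {-1, 1}"
    and e: "foldr (\<otimes>) (map2 ?pw gs es) \<one> = \<one>"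
  \<comment> \<open>Membership in the carrier is carried along so that \<open>h\<close> can be split
    over the product with the tail.\<close>
  have hom: "h (foldr (\<otimes>) (map2 ?pw gs es) \<one>) =
      foldr (\<otimes>\<^bsub>H\<^esub>) (map2 (\<lambda>g e. g [^]\<^bsub>H\<^esub> e) (map h gs) es) \<one>\<^bsub>H\<^esub> \<and>
      foldr (\<otimes>) (map2 ?pw gs es) \<one> \<in> carrier G"
    using gs(3,4)
  proof (induction gs arbitrary: es)
    case (Cons g gs)
    then obtain e es' where "es = e # es'" "length es' = length gs" by (cases es) auto
    with Cons S(1) show ?case by (auto simp: hom_int_pow)
  qed simp
  have "inj_on h (set gs)"
    using inj gs(3) S(1) by (meson inj_on_subset order_trans)
  then have "distinct (map h gs)" using gs by (simp add: distinct_map)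
  moreover have "foldr (\<otimes>\<^bsub>H\<^esub>) (map2 (\<lambda>g e. g [^]\<^bsub>H\<^esub> e) (map h gs) es) \<one>\<^bsub>H\<^esub> = \<one>\<^bsub>H\<^esub>"
    using hom e by simp
  moreover have "map h gs \<noteq> []" "set (map h gs) \<subseteq> h ` S" "length es = length (map h gs)"
    using gs by auto
  ultimately show False
    using S(2) gs(5) unfolding dissociated_def by blast
qed

text \<open>Transport of structure along an injection \<open>f\<close> into the naturals;
  \<open>h\<close> inverts \<open>f\<close>.\<close>

lemma obtain_nat_group:
  assumes "group G" "countable (carrier G)"
  obtains N :: "nat monoid" and h where
    "group_hom N G h" "bij_betw h (carrier N) (carrier G)"
proof -
  interpret group G by fact
  obtain f :: "'a \<Rightarrow> nat" where f: "inj_on f (carrier G)"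
    using assms(2) by (auto simp: countable_def)
  define h where "h = inv_into (carrier G) f"
  define N where "N = \<lparr>carrier = f ` carrier G, mult = (\<lambda>x y. f (h x \<otimes>\<^bsub>G\<^esub> h y)), one = f \<one>\<^bsub>G\<^esub>\<rparr>"
  have hf: "h (f x) = x" if "x \<in> carrier G" for x
    using f that by (simp add: h_def)
  have "group N"
    by (rule groupI) (auto simp: N_def hf m_assoc intro!: bexI[of _ "inv\<^bsub>G\<^esub> _"])
  moreover have "h \<in> hom N G"
    by (auto simp: hom_def N_def hf)
  moreover have "bij_betw h (carrier N) (carrier G)"
    by (rule bij_betw_byWitness[where f' = f]) (auto simp: N_def hf)
  ultimately show ?thesis
    using that assms(1) by (auto simp: group_hom_def group_hom_axioms_def)
qed

text \<open>Pulling back to a copy on the naturals keeps the sizes of \<open>A\<close> and of the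
  product set, and a largest dissociated subset of \<open>B\<close> stays dissociated.\<close>

lemma dim_bound_transfer:
  assumes "group G" and nat: "\<And>N :: nat monoid. group N \<Longrightarrow> dim_bound C N"
  shows "dim_bound C G"
  unfolding dim_bound_def
proof (intro allI impI, elim conjE)
  fix A B :: "'a set" and K :: nat
  assume A: "A \<subseteq> carrier G" "finite A" and B: "B \<subseteq> carrier G" "finite B"
    and K: "K > 0" "2 < card (A <#>\<^bsub>G\<^esub> B)" "card (A <#>\<^bsub>G\<^esub> B) \<le> K * card A"
  interpret group G by fact
  define H where "H = generate G (A \<union> B)"
  have AB: "A \<subseteq> H" "B \<subseteq> H" by (auto simp: H_def intro: generate.incl)
  have sub: "subgroup H G" unfolding H_def using A B by (intro generate_is_subgroup) auto
  then have grH: "group (G\<lparr>carrier := H\<rparr>)" by (rule subgroup_imp_group)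
  have "countable H"
    unfolding H_def using A B by (intro countable_generate) (auto intro: countable_finite)
  then obtain N :: "nat monoid" and h where
    N: "group_hom N (G\<lparr>carrier := H\<rparr>) h" and bij: "bij_betw h (carrier N) H"
    using obtain_nat_group[OF grH] by auto
  interpret h: group_hom N "G\<lparr>carrier := H\<rparr>" h by fact
  \<comment> \<open>Following \<open>h\<close> by the inclusion of \<open>H\<close> lets products
    and dissociation be compared in \<open>G\<close> itself.\<close>
  have hG: "group_hom N G h"
    using h.homh subgroup.subset[OF sub]
    by (auto simp: group_hom_def group_hom_axioms_def hom_def)
  have inj: "inj_on h (carrier N)" using bij by (simp add: bij_betw_def)
  define A' B' where "A' = inv_into (carrier N) h ` A" and "B' = inv_into (carrier N) h ` B"
  have im: "h ` carrier N = H" using bij by (simp add: bij_betw_def)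
  have pull: "h ` inv_into (carrier N) h ` X = X" "inv_into (carrier N) h ` X \<subseteq> carrier N"
    if "X \<subseteq> H" for X
    using that im image_inv_into_cancel[OF im that] inv_into_into[of _ h "carrier N"] by auto
  have AB': "A' \<subseteq> carrier N" "B' \<subseteq> carrier N" "h ` A' = A" "h ` B' = B" "finite A'" "finite B'"
    using pull AB A B by (auto simp: A'_def B'_def)
  have "h ` (A' <#>\<^bsub>N\<^esub> B') = A <#>\<^bsub>G\<^esub> B"
  proof -
    have "h (a \<otimes>\<^bsub>N\<^esub> b) = h a \<otimes>\<^bsub>G\<^esub> h b" if "a \<in> A'" "b \<in> B'" for a b
      using hom_mult[OF group_hom.homh[OF hG], of a b] that AB'(1,2) by blast
    then have "h ` (A' <#>\<^bsub>N\<^esub> B') = h ` A' <#>\<^bsub>G\<^esub> h ` B'"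
      by (force simp: set_mult_def image_iff)
    then show ?thesis using AB' by simp
  qed
  moreover have "A' <#>\<^bsub>N\<^esub> B' \<subseteq> carrier N"
    using h.G.set_mult_closed AB' by simp
  ultimately have cAB: "card (A' <#>\<^bsub>N\<^esub> B') = card (A <#>\<^bsub>G\<^esub> B)"
    using inj by (metis card_image inj_on_subset)
  have cA: "card A' = card A"
    using AB' inj by (metis card_image inj_on_subset)
  obtain S where S: "S \<subseteq> B" "dissociated G S" "card S = group_dim G B"
    using group_dim_attained[OF B(2)] .
  define S' where "S' = inv_into (carrier N) h ` S"
  have SH: "S \<subseteq> H" using S AB by blast
  have S': "h ` S' = S" "S' \<subseteq> carrier N" "S' \<subseteq> B'"
    using pull[OF SH] S(1) by (auto simp: S'_def B'_def)
  then have "dissociated N S'"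
    using group_hom.dissociated_image[OF hG inj S'(2)] S(2) by simp
  then have "card S' \<le> group_dim N B'"
    using S' AB' by (intro card_le_group_dim)
  moreover have "card S' = card S"
    using S' inj by (metis card_image inj_on_subset)
  ultimately have "group_dim G B \<le> group_dim N B'" using S by simp
  moreover have "group_dim N B' \<le> C * real K * ln (real K * card A') * ln (ln (real K * card A'))"
    by (rule nat[OF h.G.is_group, unfolded dim_bound_def, rule_format])
       (use AB' K cAB cA in simp)
  ultimately show "group_dim G B \<le> C * real K * ln (real K * card A) * ln (ln (real K * card A))"
    by (simp add: cA)
qed

theorem theorem8p2:
  "(\<exists>C>0. \<forall>G :: nat monoid. group G \<longrightarrow> dim_bound C G) \<and>
   (\<forall>C>0. (\<forall>G :: nat monoid. group G \<longrightarrow> dim_bound C G) \<longrightarrow>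
      (\<forall>G :: ('a, 'b) monoid_scheme. group G \<longrightarrow> dim_bound C G))"
proof (intro conjI allI impI)
  have "0 < 4 * (4 + 13 / ln (ln 3 :: real))"
    using ln_3_gt_1 by (simp add: add_pos_pos)
  then show "\<exists>C>0. \<forall>G :: nat monoid. group G \<longrightarrow> dim_bound C G"
    using group.dim_bound_explicit by blast
qed (use dim_bound_transfer in blast)

end
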